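(* Let $\mathcal{V}$ and $\mathcal{W}$ be any ordered structures such that $\mathcal{V}$ is locally finite. Suppose that there is an increasing function $f:\mathcal{W}\to\mathcal{V}$ such that for any integers $m,k\ge1$, any finite substructure $\mathcal{B}\subseteq\mathcal{V}$ and any $k$-coloring $c$ on increasing $m$-tuples from $\mathcal{W}$, there is a color-homogenizing map $g:\mathcal{B}\to\mathcal{W}$ for $c$ and $\mathcal{B}$ such that $f\circ g:\mathcal{B}\to\mathcal{V}$ is an embedding in the signature of $\mathcal{V}$. Then $\mathcal{V}$ has the Ramsey property (RP).
   Context: An ordered structure is a structure that is linearly ordered by some binary relation symbol in its signature; $\mathcal{V}$ and $\mathcal{W}$ may have different signatures. A structure is locally finite if all its finitely generated substructures are finite. An increasing tuple from an ordered structure is a finite tuple $(b_i)_{i<n}$ with $b_i$ strictly below $b_j$ iff $i<j$. An increasing function between ordered structures is one that preserves the (strict) order, so it maps increasing tuples to increasing tuples. A $k$-coloring of a set $X$ is a function $X\to\{0,\dots,k-1\}$. For tuples $\bar\imath,\bar\jmath$ of the same length from $\mathcal{V}$, $\bar\imath\sim_{\mathcal{V}}\bar\jmath$ means that they satisfy the same quantifier-free formulas in $\mathcal{V}$. Color-homogenizing maps: given integers $m,k\ge1$, a finite substructure $\mathcal{B}\subseteq\mathcal{V}$, a $k$-coloring $c$ on the increasing $m$-tuples from $\mathcal{W}$ and an increasing function $g:\mathcal{B}\to\mathcal{W}$, $g$ is color-homogenizing for $c$ and $\mathcal{B}$ if for all increasing $m$-tuples $\bar\imath,\bar\jmath$ from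 $\mathcal{B}$, $\bar\imath\sim_{\mathcal{V}}\bar\jmath$ implies $c(g(\bar\imath))=c(g(\bar\jmath))$ (with $g$ applied coordinatewise). Ramsey property: the age of a structure is the class of all its finitely generated substructures, up to isomorphism. $\binom{\mathcal{D}}{\mathcal{A}}$ denotes the set of substructures of $\mathcal{D}$ isomorphic to $\mathcal{A}$. A class $\mathcal{K}$ of finite structures has RP if for all $\mathcal{A},\mathcal{D}\in\mathcal{K}$ and every integer $k\ge 2$ there is $\mathcal{C}\in\mathcal{K}$ such that for every function $c:\binom{\mathcal{C}}{\mathcal{A}}\to\{0,\dots,k-1\}$ there is $\mathcal{D}'\in\binom{\mathcal{C}}{\mathcal{D}}$ such that $c$ is constant on $\binom{\mathcal{D}'}{\mathcal{A}}$. A locally finite structure has RP if its age has RP. *)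

theory Defs
  imports Main "HOL.Hull" "HOL-Library.FuncSet"
begin

section \<open>Signatures and structures\<close>

text \<open>
  The symbols of a signature form explicit sets, because HOL types are nonempty and a signature
  without function symbols has to be possible. Constants are function symbols of arity 0.
\<close>

record ('f, 'r) signature =
  fun_syms :: "'f set"
  rel_syms :: "'r set"
  fun_arity :: "'f \<Rightarrow> nat"
  rel_arity :: "'r \<Rightarrow> nat"

text \<open>
  Only the values of the interpretations at symbols of the signature and at tuples of the right
  length from the universe are meaningful. The universe may be empty.
\<close>

record ('f, 'r, 'a) struc =
  universe :: "'a set"
  fun_interp :: "'f \<Rightarrow> 'a list \<Rightarrow> 'a"
  rel_interp :: "'r \<Rightarrow> 'a list \<Rightarrow> bool"

definition fun_closed :: "('f, 'r) signature \<Rightarrow> ('f, 'r, 'a) struc \<Rightarrow> 'a set \<Rightarrow> bool" where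
  "fun_closed L M S \<longleftrightarrow>
    (\<forall>h\<in>fun_syms L. \<forall>xs. length xs = fun_arity L h \<and> set xs \<subseteq> S \<longrightarrow> fun_interp M h xs \<in> S)"

definition is_struc :: "('f, 'r) signature \<Rightarrow> ('f, 'r, 'a) struc \<Rightarrow> bool" where
  "is_struc L M \<longleftrightarrow> fun_closed L M (universe M)"

text \<open>
  A substructure is determined by its universe, and it is represented by the one record that
  shares the interpretations of the ambient structure (also at the meaningless arguments).
  Thus distinct substructures, in the sense of this predicate, have distinct universes.
\<close>

definition substruc ::
  "('f, 'r) signature \<Rightarrow> ('f, 'r, 'a) struc \<Rightarrow> ('f, 'r, 'a) struc \<Rightarrow> bool" where
  "substruc L N M \<longleftrightarrow>
    universe N \<subseteq> universe M \<and> fun_closed L M (universe N) \<and> N = M\<lparr>universe := universe N\<rparr>"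

definition generated_substruc ::
  "('f, 'r) signature \<Rightarrow> ('f, 'r, 'a) struc \<Rightarrow> 'a set \<Rightarrow> ('f, 'r, 'a) struc" where
  "generated_substruc L M X =
    M\<lparr>universe := (\<lambda>S. S \<subseteq> universe M \<and> fun_closed L M S) hull X\<rparr>"

definition fg_substruc ::
  "('f, 'r) signature \<Rightarrow> ('f, 'r, 'a) struc \<Rightarrow> ('f, 'r, 'a) struc \<Rightarrow> bool" where
  "fg_substruc L N M \<longleftrightarrow>
    (\<exists>X. finite X \<and> X \<subseteq> universe M \<and> N = generated_substruc L M X)"

definition locally_finite :: "('f, 'r) signature \<Rightarrow> ('f, 'r, 'a) struc \<Rightarrow> bool" where
  "locally_finite L M \<longleftrightarrow> (\<forall>N. fg_substruc L N M \<longrightarrow> finite (universe N))"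

definition is_embedding ::
  "('f, 'r) signature \<Rightarrow> ('f, 'r, 'a) struc \<Rightarrow> ('f, 'r, 'b) struc \<Rightarrow> ('a \<Rightarrow> 'b) \<Rightarrow> bool" where
  "is_embedding L M N e \<longleftrightarrow>
    e \<in> universe M \<rightarrow> universe N \<and> inj_on e (universe M) \<and>
    (\<forall>h\<in>fun_syms L. \<forall>xs. length xs = fun_arity L h \<and> set xs \<subseteq> universe M \<longrightarrow>
      e (fun_interp M h xs) = fun_interp N h (map e xs)) \<and>
    (\<forall>r\<in>rel_syms L. \<forall>xs. length xs = rel_arity L r \<and> set xs \<subseteq> universe M \<longrightarrow>
      (rel_interp M r xs \<longleftrightarrow> rel_interp N r (map e xs)))"

definition isomorphic ::
  "('f, 'r) signature \<Rightarrow> ('f, 'r, 'a) struc \<Rightarrow> ('f, 'r, 'b) struc \<Rightarrow> bool" where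
  "isomorphic L M N \<longleftrightarrow> (\<exists>e. is_embedding L M N e \<and> e ` universe M = universe N)"

section \<open>Ordered structures\<close>

text \<open>
  The order symbol \<open>s\<close> may denote a reflexive or a strict linear order; \<open>below\<close> is the strict
  order in both cases.
\<close>

definition ordered_struc :: "('f, 'r) signature \<Rightarrow> 'r \<Rightarrow> ('f, 'r, 'a) struc \<Rightarrow> bool" where
  "ordered_struc L s M \<longleftrightarrow>
    is_struc L M \<and> s \<in> rel_syms L \<and> rel_arity L s = 2 \<and>
    (let R = {(x, y). x \<in> universe M \<and> y \<in> universe M \<and> rel_interp M s [x, y]}
     in linear_order_on (universe M) R \<or> strict_linear_order_on (universe M) R)"

definition below :: "'r \<Rightarrow> ('f, 'r, 'a) struc \<Rightarrow> 'a \<Rightarrow> 'a \<Rightarrow> bool" where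
  "below s M x y \<longleftrightarrow> x \<noteq> y \<and> rel_interp M s [x, y]"

definition increasing_tuples :: "'r \<Rightarrow> ('f, 'r, 'a) struc \<Rightarrow> nat \<Rightarrow> 'a list set" where
  "increasing_tuples s M n =
    {b. length b = n \<and> set b \<subseteq> universe M \<and>
        (\<forall>i<n. \<forall>j<n. below s M (b ! i) (b ! j) \<longleftrightarrow> i < j)}"

definition increasing_fun ::
  "'r \<Rightarrow> ('f, 'r, 'a) struc \<Rightarrow> 's \<Rightarrow> ('g, 's, 'b) struc \<Rightarrow> ('a \<Rightarrow> 'b) \<Rightarrow> bool" where
  "increasing_fun s M t N h \<longleftrightarrow>
    h \<in> universe M \<rightarrow> universe N \<and>
    (\<forall>x\<in>universe M. \<forall>y\<in>universe M. below s M x y \<longrightarrow> below t N (h x) (h y))"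

section \<open>Quantifier-free formulas\<close>

datatype 'f fo_term = Var nat | App 'f "'f fo_term list"

datatype ('f, 'r) qf_form =
    Equal "'f fo_term" "'f fo_term"
  | Atom 'r "'f fo_term list"
  | Neg "('f, 'r) qf_form"
  | Conj "('f, 'r) qf_form" "('f, 'r) qf_form"
  | Disj "('f, 'r) qf_form" "('f, 'r) qf_form"

text \<open>Well-formedness over a signature, with variables among \<open>Var 0, \<dots>, Var (n - 1)\<close>.\<close>

fun wf_term :: "('f, 'r) signature \<Rightarrow> nat \<Rightarrow> 'f fo_term \<Rightarrow> bool" where
  "wf_term L n (Var i) \<longleftrightarrow> i < n"
| "wf_term L n (App h ts) \<longleftrightarrow>
    h \<in> fun_syms L \<and> length ts = fun_arity L h \<and> (\<forall>t\<in>set ts. wf_term L n t)"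

fun wf_form :: "('f, 'r) signature \<Rightarrow> nat \<Rightarrow> ('f, 'r) qf_form \<Rightarrow> bool" where
  "wf_form L n (Equal t u) \<longleftrightarrow> wf_term L n t \<and> wf_term L n u"
| "wf_form L n (Atom r ts) \<longleftrightarrow>
    r \<in> rel_syms L \<and> length ts = rel_arity L r \<and> (\<forall>t\<in>set ts. wf_term L n t)"
| "wf_form L n (Neg p) \<longleftrightarrow> wf_form L n p"
| "wf_form L n (Conj p q) \<longleftrightarrow> wf_form L n p \<and> wf_form L n q"
| "wf_form L n (Disj p q) \<longleftrightarrow> wf_form L n p \<and> wf_form L n q"

fun term_value :: "('f, 'r, 'a) struc \<Rightarrow> 'a list \<Rightarrow> 'f fo_term \<Rightarrow> 'a" where
  "term_value M a (Var i) = a ! i"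
| "term_value M a (App h ts) = fun_interp M h (map (term_value M a) ts)"

fun satisfies :: "('f, 'r, 'a) struc \<Rightarrow> 'a list \<Rightarrow> ('f, 'r) qf_form \<Rightarrow> bool" where
  "satisfies M a (Equal t u) \<longleftrightarrow> term_value M a t = term_value M a u"
| "satisfies M a (Atom r ts) \<longleftrightarrow> rel_interp M r (map (term_value M a) ts)"
| "satisfies M a (Neg p) \<longleftrightarrow> \<not> satisfies M a p"
| "satisfies M a (Conj p q) \<longleftrightarrow> satisfies M a p \<and> satisfies M a q"
| "satisfies M a (Disj p q) \<longleftrightarrow> satisfies M a p \<or> satisfies M a q"

definition qf_equiv ::
  "('f, 'r) signature \<Rightarrow> ('f, 'r, 'a) struc \<Rightarrow> 'a list \<Rightarrow> 'a list \<Rightarrow> bool" where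
  "qf_equiv L M a b \<longleftrightarrow>
    length a = length b \<and>
    (\<forall>p. wf_form L (length a) p \<longrightarrow> (satisfies M a p \<longleftrightarrow> satisfies M b p))"

section \<open>Color-homogenizing maps\<close>

definition is_coloring :: "nat \<Rightarrow> 'x set \<Rightarrow> ('x \<Rightarrow> nat) \<Rightarrow> bool" where
  "is_coloring k X c \<longleftrightarrow> c \<in> X \<rightarrow> {..<k}"

definition color_homogenizing ::
  "('f, 'r) signature \<Rightarrow> 'r \<Rightarrow> ('f, 'r, 'a) struc \<Rightarrow> 's \<Rightarrow> ('g, 's, 'b) struc \<Rightarrow>
    nat \<Rightarrow> ('b list \<Rightarrow> nat) \<Rightarrow> ('f, 'r, 'a) struc \<Rightarrow> ('a \<Rightarrow> 'b) \<Rightarrow> bool" where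
  "color_homogenizing L s V t W m c B g \<longleftrightarrow>
    increasing_fun s B t W g \<and>
    (\<forall>a\<in>increasing_tuples s B m. \<forall>b\<in>increasing_tuples s B m.
      qf_equiv L V a b \<longrightarrow> c (map g a) = c (map g b))"

section \<open>The Ramsey property\<close>

text \<open>
  The age is closed under isomorphism among the structures with universe in the type \<open>'a\<close>
  of \<open>M\<close>; every isomorphism type of the age is represented there.
\<close>

definition age :: "('f, 'r) signature \<Rightarrow> ('f, 'r, 'a) struc \<Rightarrow> ('f, 'r, 'a) struc set" where
  "age L M = {A. is_struc L A \<and> (\<exists>N. fg_substruc L N M \<and> isomorphic L A N)}"

definition copies ::
  "('f, 'r) signature \<Rightarrow> ('f, 'r, 'a) struc \<Rightarrow> ('f, 'r, 'a) struc \<Rightarrow> ('f, 'r, 'a) struc set" where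
  "copies L D A = {N. substruc L N D \<and> isomorphic L N A}"

definition class_has_RP :: "('f, 'r) signature \<Rightarrow> ('f, 'r, 'a) struc set \<Rightarrow> bool" where
  "class_has_RP L K \<longleftrightarrow>
    (\<forall>A\<in>K. \<forall>D\<in>K. \<forall>k\<ge>2. \<exists>C\<in>K. \<forall>c. is_coloring k (copies L C A) c \<longrightarrow>
      (\<exists>D'\<in>copies L C D. \<forall>X\<in>copies L D' A. \<forall>Y\<in>copies L D' A. c X = c Y))"

definition has_RP :: "('f, 'r) signature \<Rightarrow> ('f, 'r, 'a) struc \<Rightarrow> bool" where
  "has_RP L M \<longleftrightarrow> class_has_RP L (age L M)"

end

theory Submission
  imports Defs "HOL-Analysis.Function_Topology"
begin

text \<open>
  Suppose first that the finite structure \<open>C\<close> demanded by the Ramsey property could be replaced by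
  the whole of \<open>V\<close>: every coloring of all copies of \<open>A\<close> in \<open>V\<close> with finitely many colors makes
  the copies of \<open>A\<close> inside some copy of \<open>D\<close> monochromatic. Then a finite \<open>C\<close> exists by compactness
  (\<open>finite_ramsey_witness\<close>). Otherwise every finite substructure of \<open>V\<close> has a bad coloring, and
  the condition that a coloring is bad concerns one copy of \<open>D\<close>, hence finitely many copies of
  \<open>A\<close>, at a time. Since finitely many copies of \<open>D\<close> lie in a common finite substructure, the
  theorem of de Bruijn and Erdos for hypergraphs
  (\<open>finite_nonmonochromatic_imp_nonmonochromatic\<close>) yields a coloring which is bad for all of \<open>V\<close>.

  It remains to find a monochromatic copy of \<open>D\<close> for a coloring \<open>c\<close> of the copies of \<open>A\<close> in
  \<open>V\<close> (\<open>monochromatic_copy\<close>). The map \<open>f\<close> from \<open>W\<close> to \<open>V\<close> pulls \<open>c\<close> back to tuples of \<open>W\<close>: a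
  tuple \<open>w\<close> gets the color of the restriction of \<open>V\<close> to the entries of \<open>f(w)\<close>. Take a
  color-homogenizing \<open>g\<close> for this coloring on a copy \<open>B\<close> of \<open>D\<close> in \<open>V\<close>. Then the image of \<open>B\<close> under
  the embedding \<open>f \<circ> g\<close> is monochromatic. Indeed, a fixed increasing enumeration of a copy of
  \<open>A\<close> in \<open>V\<close> is carried by the embeddings of this copy into \<open>B\<close> to increasing tuples of \<open>B\<close>, and all
  of them satisfy the same quantifier-free formulas, since embeddings preserve such formulas
  (\<open>embedding_qf_equiv\<close>). So \<open>g\<close> gives them one color, and their images under \<open>f \<circ> g\<close> enumerate
  all copies of \<open>A\<close> in the image of \<open>B\<close>.
\<close>

section \<open>Compactness for hypergraph colorings\<close>

text \<open>
  This is the theorem of de Bruijn and Erdos for hypergraphs with finite edges. By Tychonoff's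
  theorem the space of all colorings is compact, and the colorings that are not constant on a
  given finite edge form a closed set, as they depend on finitely many coordinates only.
\<close>

lemma finite_nonmonochromatic_imp_nonmonochromatic:
  fixes H :: "'x set set" and k :: nat
  assumes fin: "\<And>E. E \<in> H \<Longrightarrow> finite E"
    and sub: "\<And>H'. finite H' \<Longrightarrow> H' \<subseteq> H \<Longrightarrow>
      \<exists>c. (\<forall>x. c x < k) \<and> (\<forall>E\<in>H'. \<exists>x\<in>E. \<exists>y\<in>E. c x \<noteq> c y)"
  shows "\<exists>c. (\<forall>x. c x < k) \<and> (\<forall>E\<in>H. \<exists>x\<in>E. \<exists>y\<in>E. c x \<noteq> c y)"
proof -
  let ?K = "PiE UNIV (\<lambda>_::'x. {..<k})"
  let ?F = "\<lambda>E. \<Union>x\<in>E. \<Union>y\<in>E. {c :: 'x \<Rightarrow> nat. c x \<noteq> c y}"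
  have "compactin (product_topology (\<lambda>_::'x. euclidean :: nat topology) UNIV) ?K"
    unfolding compactin_PiE by (simp add: finite_imp_compact)
  then have "compact ?K"
    by (simp add: euclidean_product_topology)
  moreover have "closed (?F E)" if "E \<in> H" for E
  proof -
    have "closed {c :: 'x \<Rightarrow> nat. c x \<noteq> c y}" for x y
    proof -
      have eq: "{c :: 'x \<Rightarrow> nat. c x = c y} = (\<Union>n. (\<lambda>c. c x) -` {n} \<inter> (\<lambda>c. c y) -` {n})"
        by auto
      have "open ((\<lambda>c :: 'x \<Rightarrow> nat. c z) -` {n})" for z n
        by (intro open_vimage open_discrete continuous_on_product_coordinates)
      then have "open {c :: 'x \<Rightarrow> nat. c x = c y}"
        unfolding eq by blast
      then show ?thesis
        by (simp add: closed_def Compl_eq)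
    qed
    then show ?thesis
      using fin[OF that] by (intro closed_UN) auto
  qed
  moreover have "?K \<inter> (\<Inter>E\<in>H'. ?F E) \<noteq> {}" if "finite H'" "H' \<subseteq> H" for H'
  proof -
    obtain c where "\<forall>x. c x < k" "\<forall>E\<in>H'. \<exists>x\<in>E. \<exists>y\<in>E. c x \<noteq> c y"
      using sub[OF \<open>finite H'\<close> \<open>H' \<subseteq> H\<close>] by blast
    then have "c \<in> ?K \<inter> (\<Inter>E\<in>H'. ?F E)"
      by (simp add: PiE_iff)
    then show ?thesis
      by blast
  qed
  ultimately have "?K \<inter> (\<Inter>E\<in>H. ?F E) \<noteq> {}"
    by (rule compact_imp_fip_image[of ?K H ?F])
  then obtain c where "c \<in> ?K \<inter> (\<Inter>E\<in>H. ?F E)"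
    unfolding ex_in_conv [symmetric] ..
  then show ?thesis
    by (intro exI[of _ c]) (auto simp: PiE_iff)
qed

section \<open>Substructures, embeddings and isomorphisms\<close>

lemma substruc_is_struc: "substruc L N M \<Longrightarrow> is_struc L N"
  unfolding substruc_def is_struc_def fun_closed_def
  by (metis struc.select_convs(2) struc.surjective struc.update_convs(1))

lemma substruc_restrict:
  "X \<subseteq> universe M \<Longrightarrow> fun_closed L M X \<Longrightarrow> substruc L (M\<lparr>universe := X\<rparr>) M"
  by (simp add: substruc_def)

lemma substruc_eq_restrict:
  assumes "substruc L N M"
  obtains X where "N = M\<lparr>universe := X\<rparr>" "X \<subseteq> universe M" "fun_closed L M X"
  using assms unfolding substruc_def by blast

lemma fun_closed_restrict [simp]: "fun_closed L (M\<lparr>universe := X\<rparr>) = fun_closed L M"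
  by (simp add: fun_closed_def fun_eq_iff)

lemma substruc_trans: "substruc L N M \<Longrightarrow> substruc L M P \<Longrightarrow> substruc L N P"
  by (elim substruc_eq_restrict) (auto intro!: substruc_restrict)

lemma substruc_subset:
  "substruc L N P \<Longrightarrow> substruc L M P \<Longrightarrow> universe N \<subseteq> universe M \<Longrightarrow> substruc L N M"
  by (elim substruc_eq_restrict) (simp add: substruc_def)

lemma substruc_unique:
  "substruc L N M \<Longrightarrow> substruc L P M \<Longrightarrow> universe N = universe P \<Longrightarrow> N = P"
  by (elim substruc_eq_restrict) simp

lemma finite_substrucs:
  assumes "finite (universe M)"
  shows "finite {N. substruc L N M}"
proof (rule finite_subset)
  show "{N. substruc L N M} \<subseteq> (\<lambda>X. M\<lparr>universe := X\<rparr>) ` Pow (universe M)"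
    by (auto elim!: substruc_eq_restrict)
qed (use assms in simp)

lemma is_embedding_comp:
  assumes "is_embedding L M N e" "is_embedding L N P h"
  shows "is_embedding L M P (h \<circ> e)"
proof -
  have e: "e x \<in> universe N" if "x \<in> universe M" for x
    using assms(1) that unfolding is_embedding_def by blast
  have set_e: "set (map e xs) \<subseteq> universe N" if "set xs \<subseteq> universe M" for xs
    using e that by auto
  have "inj_on (h \<circ> e) (universe M)"
    using assms e unfolding is_embedding_def inj_on_def by (metis comp_apply)
  moreover have "h \<circ> e \<in> universe M \<rightarrow> universe P"
    using assms unfolding is_embedding_def by (auto simp: Pi_iff)
  moreover have "(h \<circ> e) (fun_interp M u xs) = fun_interp P u (map (h \<circ> e) xs)"
    if "u \<in> fun_syms L" "length xs = fun_arity L u" "set xs \<subseteq> universe M" for u xs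
    using assms that set_e[OF that(3)] unfolding is_embedding_def
    by (metis comp_apply length_map map_map)
  moreover have "rel_interp M r xs \<longleftrightarrow> rel_interp P r (map (h \<circ> e) xs)"
    if "r \<in> rel_syms L" "length xs = rel_arity L r" "set xs \<subseteq> universe M" for r xs
    using assms that set_e[OF that(3)] unfolding is_embedding_def
    by (metis length_map map_map)
  ultimately show ?thesis
    unfolding is_embedding_def by blast
qed

lemma is_embedding_inv_into:
  assumes "is_struc L M" and e: "is_embedding L M N e" and onto: "e ` universe M = universe N"
  shows "is_embedding L N M (inv_into (universe M) e)"
proof -
  let ?i = "inv_into (universe M) e"
  have inj: "inj_on e (universe M)"
    using e by (simp add: is_embedding_def)
  have i: "?i y \<in> universe M" "e (?i y) = y" if "y \<in> universe N" for y
    using that onto by (auto intro: inv_into_into f_inv_into_f)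
  have ys: "map e (map ?i ys) = ys" "set (map ?i ys) \<subseteq> universe M" if "set ys \<subseteq> universe N" for ys
    using that i by (auto intro!: map_idI)
  have "?i (fun_interp N u ys) = fun_interp M u (map ?i ys)"
    if "u \<in> fun_syms L" "length ys = fun_arity L u" "set ys \<subseteq> universe N" for u ys
  proof -
    have "fun_interp M u (map ?i ys) \<in> universe M"
      using assms(1) that ys(2)[OF that(3)] unfolding is_struc_def fun_closed_def
      by (metis length_map)
    moreover have "e (fun_interp M u (map ?i ys)) = fun_interp N u ys"
      using e that ys[OF that(3)] unfolding is_embedding_def by (metis length_map)
    ultimately show ?thesis
      using inj by (metis inv_into_f_f)
  qed
  moreover have "rel_interp N r ys \<longleftrightarrow> rel_interp M r (map ?i ys)"
    if "r \<in> rel_syms L" "length ys = rel_arity L r" "set ys \<subseteq> universe N" for r ys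
    using e that ys[OF that(3)] unfolding is_embedding_def by (metis length_map)
  moreover have "inj_on ?i (universe N)"
    using onto by (simp add: inj_on_inv_into)
  ultimately show ?thesis
    using i(1) unfolding is_embedding_def by blast
qed

lemma isomorphic_sym:
  assumes "is_struc L M" "isomorphic L M N"
  shows "isomorphic L N M"
proof -
  obtain e where e: "is_embedding L M N e" "e ` universe M = universe N"
    using assms(2) unfolding isomorphic_def by blast
  have "inv_into (universe M) e ` universe N = universe M"
    using inv_into_image_cancel[of e "universe M" "universe M"] e by (simp add: is_embedding_def)
  then show ?thesis
    unfolding isomorphic_def
    by (intro exI[of _ "inv_into (universe M) e"] conjI is_embedding_inv_into[OF assms(1) e])
qed

lemma isomorphic_trans:
  assumes "isomorphic L M N" "isomorphic L N P"
  shows "isomorphic L M P"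
proof -
  obtain e h where "is_embedding L M N e" "e ` universe M = universe N"
      "is_embedding L N P h" "h ` universe N = universe P"
    using assms unfolding isomorphic_def by blast
  then have "is_embedding L M P (h \<circ> e)" "(h \<circ> e) ` universe M = universe P"
    by (auto intro: is_embedding_comp simp only: image_comp [symmetric])
  then show ?thesis
    unfolding isomorphic_def by (intro exI conjI)
qed

lemma is_embedding_substruc: "substruc L N M \<Longrightarrow> is_embedding L N M id"
  by (elim substruc_eq_restrict) (auto simp: is_embedding_def)

lemma embedding_image_substruc:
  assumes h: "is_embedding L B V h" and B: "is_struc L B"
  shows "substruc L (V\<lparr>universe := h ` universe B\<rparr>) V"
    and "is_embedding L B (V\<lparr>universe := h ` universe B\<rparr>) h"
proof -
  have "fun_interp V u ys \<in> h ` universe B"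
    if u: "u \<in> fun_syms L" "length ys = fun_arity L u" and ys: "set ys \<subseteq> h ` universe B" for u ys
  proof -
    obtain xs where xs: "set xs \<subseteq> universe B" "ys = map h xs"
    proof -
      have "ys \<in> map h ` lists (universe B)"
        unfolding lists_image [symmetric] using ys by blast
      then show thesis
        using that by auto
    qed
    then have "fun_interp B u xs \<in> universe B"
      using B u unfolding is_struc_def fun_closed_def by auto
    moreover have "h (fun_interp B u xs) = fun_interp V u ys"
      using h u xs unfolding is_embedding_def by auto
    ultimately show ?thesis
      by (metis imageI)
  qed
  moreover have "h ` universe B \<subseteq> universe V"
    using h by (auto simp: is_embedding_def)
  ultimately show "substruc L (V\<lparr>universe := h ` universe B\<rparr>) V"
    by (intro substruc_restrict) (auto simp: fun_closed_def)
  show "is_embedding L B (V\<lparr>universe := h ` universe B\<rparr>) h"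
    using h by (auto simp: is_embedding_def)
qed

section \<open>Finite substructures and the age\<close>

lemma fun_closed_hull:
  "fun_closed L M ((\<lambda>S. S \<subseteq> universe M \<and> fun_closed L M S) hull X)"
  unfolding fun_closed_def hull_def by blast

lemma generated_substruc_substruc:
  assumes "is_struc L M" "X \<subseteq> universe M"
  shows "substruc L (generated_substruc L M X) M"
  unfolding generated_substruc_def
proof (rule substruc_restrict[OF _ fun_closed_hull])
  show "(\<lambda>S. S \<subseteq> universe M \<and> fun_closed L M S) hull X \<subseteq> universe M"
    using assms by (intro hull_minimal) (auto simp: is_struc_def)
qed

lemma subset_generated_substruc: "X \<subseteq> universe (generated_substruc L M X)"
  by (simp add: generated_substruc_def hull_subset)

lemma finite_substruc_fg:
  assumes "substruc L N M" "finite (universe N)"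
  shows "fg_substruc L N M"
proof -
  have "generated_substruc L M (universe N) = N"
    using assms unfolding generated_substruc_def substruc_def by (subst hull_same) auto
  then show ?thesis
    using assms unfolding fg_substruc_def substruc_def by metis
qed

lemma finite_substruc_in_age:
  assumes "substruc L N M" "finite (universe N)"
  shows "N \<in> age L M"
proof -
  have "isomorphic L N N"
    unfolding isomorphic_def by (intro exI[of _ id]) (auto simp: is_embedding_def)
  then show ?thesis
    using assms finite_substruc_fg substruc_is_struc unfolding age_def by blast
qed

lemma finite_substruc_containing:
  assumes "is_struc L M" "locally_finite L M" "finite X" "X \<subseteq> universe M"
  obtains C where "substruc L C M" "finite (universe C)" "X \<subseteq> universe C"
proof
  show "substruc L (generated_substruc L M X) M"
    using assms by (simp add: generated_substruc_substruc)
  show "finite (universe (generated_substruc L M X))"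
    using assms unfolding locally_finite_def fg_substruc_def by blast
  show "X \<subseteq> universe (generated_substruc L M X)"
    by (rule subset_generated_substruc)
qed

lemma age_copy:
  assumes "is_struc L M" "locally_finite L M" "A \<in> age L M"
  obtains N where "N \<in> copies L M A" "finite (universe N)"
proof -
  obtain N where "is_struc L A" and N: "fg_substruc L N M" "isomorphic L A N"
    using assms(3) by (auto simp: age_def)
  then have "isomorphic L N A"
    by (simp add: isomorphic_sym)
  moreover have "substruc L N M"
    using N(1) generated_substruc_substruc[OF assms(1)] by (auto simp: fg_substruc_def)
  moreover have "finite (universe N)"
    using assms(2) N(1) by (simp add: locally_finite_def)
  ultimately show thesis
    using that by (simp add: copies_def)
qed

lemma age_finite_copies:
  assumes "locally_finite L M" "A \<in> age L M" "N \<in> copies L P A"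
  shows "finite (universe N)"
proof -
  obtain N' where N': "fg_substruc L N' M" "isomorphic L A N'"
    using assms(2) by (auto simp: age_def)
  then have "isomorphic L N N'"
    using assms(3) isomorphic_trans by (auto simp: copies_def)
  then obtain e where "inj_on e (universe N)" "e ` universe N = universe N'"
    by (auto simp: isomorphic_def is_embedding_def)
  moreover have "finite (universe N')"
    using assms(1) N'(1) by (simp add: locally_finite_def)
  ultimately show ?thesis
    by (metis finite_imageD)
qed

lemma copies_mono: "substruc L D C \<Longrightarrow> copies L D A \<subseteq> copies L C A"
  by (auto simp: copies_def intro: substruc_trans)

text \<open>
  The edges of the hypergraph are the sets of copies of \<open>A\<close> inside a copy of \<open>D\<close>. Finitely many
  of them are induced by copies of \<open>D\<close> inside one finite substructure of \<open>M\<close>, which belongs to the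
  age.
\<close>

lemma finite_ramsey_witness:
  fixes k :: nat
  assumes M: "is_struc L M" "locally_finite L M" and D: "D \<in> age L M" and "k > 0"
    and mono: "\<And>c. (\<And>X. c X < k) \<Longrightarrow>
      \<exists>D'\<in>copies L M D. \<forall>X\<in>copies L D' A. \<forall>Y\<in>copies L D' A. c X = c Y"
  shows "\<exists>C\<in>age L M. \<forall>c. is_coloring k (copies L C A) c \<longrightarrow>
    (\<exists>D'\<in>copies L C D. \<forall>X\<in>copies L D' A. \<forall>Y\<in>copies L D' A. c X = c Y)"
proof (rule ccontr)
  assume contra: "\<not> ?thesis"
  have bad: "\<exists>c. is_coloring k (copies L C A) c \<and>
    (\<forall>D'\<in>copies L C D. \<exists>X\<in>copies L D' A. \<exists>Y\<in>copies L D' A. c X \<noteq> c Y)"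
    if "substruc L C M" "finite (universe C)" for C
    using contra finite_substruc_in_age[OF that] by simp
  let ?H = "(\<lambda>D'. copies L D' A) ` copies L M D"
  have "\<exists>c. (\<forall>X. c X < k) \<and> (\<forall>E\<in>?H. \<exists>X\<in>E. \<exists>Y\<in>E. c X \<noteq> c Y)"
  proof (rule finite_nonmonochromatic_imp_nonmonochromatic)
    fix E assume "E \<in> ?H"
    then obtain D' where "D' \<in> copies L M D" "E = copies L D' A"
      by blast
    then show "finite E"
      using finite_substrucs[OF age_finite_copies[OF M(2) D], of D' M L]
      unfolding copies_def by (auto elim: rev_finite_subset)
  next
    fix H' assume "finite H'" "H' \<subseteq> ?H"
    then obtain \<D> where \<D>: "finite \<D>" "\<D> \<subseteq> copies L M D" "H' = (\<lambda>D'. copies L D' A) ` \<D>"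
      by (metis finite_subset_image)
    have "finite (\<Union>(universe ` \<D>))"
      using \<D> age_finite_copies[OF M(2) D] by blast
    moreover have "\<Union>(universe ` \<D>) \<subseteq> universe M"
      using \<D>(2) by (auto simp: copies_def substruc_def)
    ultimately obtain C where C: "substruc L C M" "finite (universe C)"
        "\<Union>(universe ` \<D>) \<subseteq> universe C"
      using finite_substruc_containing[OF M] by metis
    obtain c where c: "is_coloring k (copies L C A) c"
        "\<forall>D'\<in>copies L C D. \<exists>X\<in>copies L D' A. \<exists>Y\<in>copies L D' A. c X \<noteq> c Y"
      using bad[OF C(1,2)] by blast
    \<comment> \<open>The edges in \<open>H'\<close> consist of copies of \<open>A\<close> in \<open>C\<close>, so any default color will do elsewhere.\<close>
    let ?c = "\<lambda>X. if X \<in> copies L C A then c X else 0"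
    have "\<exists>X\<in>copies L D' A. \<exists>Y\<in>copies L D' A. ?c X \<noteq> ?c Y" if "D' \<in> \<D>" for D'
    proof -
      have sub: "substruc L D' C"
        using \<D>(2) C that by (intro substruc_subset[of L D' M C]) (auto simp: copies_def)
      then have "D' \<in> copies L C D"
        using \<D>(2) that by (auto simp: copies_def)
      then obtain X Y where "X \<in> copies L D' A" "Y \<in> copies L D' A" "c X \<noteq> c Y"
        using c(2) by blast
      then show ?thesis
        using copies_mono[OF sub, of A] by (metis subsetD)
    qed
    then show "\<exists>c. (\<forall>X. c X < k) \<and> (\<forall>E\<in>H'. \<exists>X\<in>E. \<exists>Y\<in>E. c X \<noteq> c Y)"
      using c(1) \<open>k > 0\<close> \<D>(3) by (intro exI[of _ ?c]) (auto simp: is_coloring_def)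
  qed
  then show False
    using mono by simp metis
qed

section \<open>Quantifier-free formulas under embeddings\<close>

lemma term_value_in_universe:
  assumes "is_struc L N" "set a \<subseteq> universe N" "wf_term L (length a) u"
  shows "term_value N a u \<in> universe N"
  using assms(3)
proof (induction u)
  case (Var i)
  then show ?case using assms(2) by auto
next
  case (App h us)
  then have "set (map (term_value N a) us) \<subseteq> universe N"
    by auto
  then show ?case
    using assms(1) App.prems unfolding is_struc_def fun_closed_def
    by (metis length_map term_value.simps(2) wf_term.simps(2))
qed

lemma term_value_embedding:
  assumes N: "is_struc L N" and e: "is_embedding L N M e" and a: "set a \<subseteq> universe N"
    and "wf_term L (length a) u"
  shows "term_value M (map e a) u = e (term_value N a u)"
  using assms(4)
proof (induction u)
  case (Var i)
  then show ?case by simp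
next
  case (App h us)
  have eq: "map (term_value M (map e a)) us = map e (map (term_value N a) us)"
    using App by simp
  have "set (map (term_value N a) us) \<subseteq> universe N"
    using App.prems term_value_in_universe[OF N a] by auto
  then have "e (fun_interp N h (map (term_value N a) us))
      = fun_interp M h (map e (map (term_value N a) us))"
    using e App.prems unfolding is_embedding_def by (metis length_map wf_term.simps(2))
  then show ?case
    unfolding term_value.simps eq by simp
qed

lemma satisfies_embedding:
  assumes N: "is_struc L N" and e: "is_embedding L N M e" and a: "set a \<subseteq> universe N"
    and "wf_form L (length a) p"
  shows "satisfies M (map e a) p \<longleftrightarrow> satisfies N a p"
  using assms(4)
proof (induction p)
  case (Equal u v)
  then show ?case
    using e term_value_embedding[OF N e a] term_value_in_universe[OF N a]
    by (auto simp: is_embedding_def inj_on_eq_iff)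
next
  case (Atom r us)
  have eq: "map (term_value M (map e a)) us = map e (map (term_value N a) us)"
    using Atom term_value_embedding[OF N e a] by simp
  have "set (map (term_value N a) us) \<subseteq> universe N"
    using Atom term_value_in_universe[OF N a] by auto
  then have "rel_interp N r (map (term_value N a) us)
      \<longleftrightarrow> rel_interp M r (map e (map (term_value N a) us))"
    using e Atom unfolding is_embedding_def by (metis length_map wf_form.simps(2))
  then show ?case
    unfolding satisfies.simps eq by simp
qed auto

lemma embedding_qf_equiv:
  assumes "is_struc L N" "is_embedding L N M e" "is_embedding L N M e'" "set a \<subseteq> universe N"
  shows "qf_equiv L M (map e a) (map e' a)"
  using assms by (simp add: qf_equiv_def satisfies_embedding)

section \<open>Increasing tuples\<close>

lemma strict_linear_below:
  assumes "ordered_struc L s M"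
  shows "\<And>x. \<not> below s M x x"
    and "\<And>x y. x \<in> universe M \<Longrightarrow> y \<in> universe M \<Longrightarrow> below s M x y \<Longrightarrow> \<not> below s M y x"
    and "\<And>x y z. x \<in> universe M \<Longrightarrow> y \<in> universe M \<Longrightarrow> z \<in> universe M \<Longrightarrow>
      below s M x y \<Longrightarrow> below s M y z \<Longrightarrow> below s M x z"
    and "\<And>x y. x \<in> universe M \<Longrightarrow> y \<in> universe M \<Longrightarrow> x \<noteq> y \<Longrightarrow> below s M x y \<or> below s M y x"
proof -
  let ?R = "{(x, y). x \<in> universe M \<and> y \<in> universe M \<and> rel_interp M s [x, y]}"
  have *: "linear_order_on (universe M) ?R \<or> strict_linear_order_on (universe M) ?R"
    using assms by (simp add: ordered_struc_def Let_def)
  then have tr: "trans ?R" and tot: "total_on (universe M) ?R"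
    by (auto simp: order_on_defs)
  have as: "x = y" if "(x, y) \<in> ?R" "(y, x) \<in> ?R" for x y
  proof (cases "antisym ?R")
    case True
    then show ?thesis using that by (rule antisymD)
  next
    case False
    then have "irrefl ?R"
      using * by (auto simp: order_on_defs)
    then show ?thesis
      using transD[OF tr that] by (auto simp: irrefl_def)
  qed
  show "\<not> below s M x x" for x
    by (simp add: below_def)
  show asym: "\<not> below s M y x"
    if "x \<in> universe M" "y \<in> universe M" "below s M x y" for x y
    using as[of x y] that by (auto simp: below_def)
  show "below s M x z"
    if "x \<in> universe M" "y \<in> universe M" "z \<in> universe M" "below s M x y" "below s M y z" for x y z
    using transD[OF tr, of x y z] that asym[of x y] by (auto simp: below_def)
  show "below s M x y \<or> below s M y x"
    if "x \<in> universe M" "y \<in> universe M" "x \<noteq> y" for x y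
    using tot that by (auto simp: below_def total_on_def)
qed

lemma increasing_enumeration:
  assumes M: "ordered_struc L s M" and "finite X" "X \<subseteq> universe M"
  obtains a where "a \<in> increasing_tuples s M (length a)" "set a = X"
proof -
  note below = strict_linear_below[OF M]
  have "\<exists>a. sorted_wrt (below s M) a \<and> set a = X"
    using assms(2,3)
  proof (induction X)
    case empty
    show ?case by simp
  next
    case (insert x X)
    then obtain a where a: "sorted_wrt (below s M) a" "set a = X"
      by blast
    let ?b = "filter (\<lambda>y. below s M y x) a @ x # filter (below s M x) a"
    have "below s M y z" if "y \<in> set a" "z \<in> set a" "below s M y x" "below s M x z" for y z
      using below(3)[of y x z] that a(2) insert.prems by blast
    then have "sorted_wrt (below s M) ?b"
      using a(1) by (simp add: sorted_wrt_append sorted_wrt_filter)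
    moreover have "set ?b = insert x X"
      using a insert below(4) by auto
    ultimately show ?case
      by blast
  qed
  then obtain a where a: "sorted_wrt (below s M) a" "set a = X"
    by blast
  have "below s M (a ! i) (a ! j) \<longleftrightarrow> i < j" if ij: "i < length a" "j < length a" for i j
  proof (cases i j rule: linorder_cases)
    case less
    then show ?thesis
      using a(1) ij by (simp add: sorted_wrt_iff_nth_less)
  next
    case equal
    then show ?thesis
      by (simp add: below(1))
  next
    case greater
    then have "below s M (a ! j) (a ! i)"
      using a(1) ij by (simp add: sorted_wrt_iff_nth_less)
    then show ?thesis
      using greater below(2)[of "a ! j" "a ! i"] a(2) assms(3) ij
      by (metis nth_mem order_less_asym subsetD)
  qed
  then have "a \<in> increasing_tuples s M (length a)"
    using a(2) assms(3) by (simp add: increasing_tuples_def)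
  then show thesis
    using that a(2) by blast
qed

lemma increasing_tuple_embedding:
  assumes "s \<in> rel_syms L" "rel_arity L s = 2" and e: "is_embedding L N M e"
    and a: "a \<in> increasing_tuples s N n"
  shows "map e a \<in> increasing_tuples s M n"
proof -
  have sub: "set a \<subseteq> universe N"
    using a by (simp add: increasing_tuples_def)
  have "below s M (e x) (e y) \<longleftrightarrow> below s N x y" if "x \<in> set a" "y \<in> set a" for x y
  proof -
    have xy: "x \<in> universe N" "y \<in> universe N"
      using sub that by auto
    then have "e x = e y \<longleftrightarrow> x = y"
      using e by (auto simp: is_embedding_def inj_on_eq_iff)
    moreover have "rel_interp N s [x, y] \<longleftrightarrow> rel_interp M s (map e [x, y])"
      using e assms(1,2) xy unfolding is_embedding_def by (auto simp del: list.map)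
    ultimately show ?thesis
      by (simp add: below_def)
  qed
  then show ?thesis
    using a e by (auto simp: increasing_tuples_def is_embedding_def)
qed

section \<open>From color-homogenizing maps to the Ramsey property\<close>

text \<open>
  The existence of \<open>g\<close> is assumed for tuples of positive length. If \<open>A\<close> is empty, then
  all copies of \<open>A\<close> inside a copy of \<open>D\<close> coincide, so any copy of \<open>D\<close> is monochromatic.
\<close>

lemma monochromatic_copy:
  fixes V :: "('f, 'r, 'v) struc" and W :: "('g, 's, 'w) struc" and k :: nat
  assumes V: "ordered_struc L s V" "locally_finite L V"
    and A: "A \<in> age L V" and D: "D \<in> age L V"
    and hom: "\<And>m B c. m \<ge> 1 \<Longrightarrow> substruc L B V \<Longrightarrow> finite (universe B) \<Longrightarrow>
        is_coloring k (increasing_tuples t W m) c \<Longrightarrow>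
        \<exists>g. color_homogenizing L s V t W m c B g \<and> is_embedding L B V (f \<circ> g)"
    and c: "\<And>X. c X < k"
  shows "\<exists>D'\<in>copies L V D. \<forall>X\<in>copies L D' A. \<forall>Y\<in>copies L D' A. c X = c Y"
proof -
  have sV: "is_struc L V" and s: "s \<in> rel_syms L" "rel_arity L s = 2"
    using V(1) by (auto simp: ordered_struc_def)
  obtain B where B: "B \<in> copies L V D" "finite (universe B)"
    using age_copy[OF sV V(2) D] by blast
  then have subB: "substruc L B V" and BD: "isomorphic L B D"
    by (auto simp: copies_def)
  have sB: "is_struc L B"
    using subB by (rule substruc_is_struc)
  obtain A0 where A0: "A0 \<in> copies L V A" "finite (universe A0)"
    using age_copy[OF sV V(2) A] by blast
  then have subA0: "substruc L A0 V" and A0A: "isomorphic L A0 A"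
    by (auto simp: copies_def)
  have sA0: "is_struc L A0"
    using subA0 by (rule substruc_is_struc)
  have iso: "\<exists>e. is_embedding L A0 X e \<and> e ` universe A0 = universe X"
    if "X \<in> copies L P A" for X and P :: "('f, 'r, 'v) struc"
  proof -
    have "isomorphic L A X"
      using that isomorphic_sym[OF substruc_is_struc] by (auto simp: copies_def)
    then show ?thesis
      using isomorphic_trans[OF A0A] by (simp add: isomorphic_def)
  qed
  show ?thesis
  proof (cases "universe A0 = {}")
    case True
    have "X = Y" if "X \<in> copies L B A" "Y \<in> copies L B A" for X Y
    proof (rule substruc_unique)
      show "substruc L X B" "substruc L Y B"
        using that by (auto simp: copies_def)
      show "universe X = universe Y"
        using iso[OF that(1)] iso[OF that(2)] True by auto
    qed
    then show ?thesis
      using B(1) by metis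
  next
    case False
    obtain a where a: "a \<in> increasing_tuples s V (length a)" "set a = universe A0"
      using increasing_enumeration[OF V(1) A0(2)] subA0 by (auto simp: substruc_def)
    \<comment> \<open>The entries of \<open>f(w)\<close> need not form a copy of \<open>A\<close>, nor be closed under the functions.
      The color of such a tuple \<open>w\<close> is arbitrary.\<close>
    let ?c = "\<lambda>w. c (V\<lparr>universe := f ` set w\<rparr>)"
    have "length a \<ge> 1"
      using a(2) False by (cases a) auto
    moreover have "is_coloring k (increasing_tuples t W (length a)) ?c"
      using c by (simp add: is_coloring_def)
    ultimately obtain g where g: "color_homogenizing L s V t W (length a) ?c B g"
        and fg: "is_embedding L B V (f \<circ> g)"
      using hom[OF _ subB B(2)] by blast
    define D' where "D' = V\<lparr>universe := (f \<circ> g) ` universe B\<rparr>"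
    have subD': "substruc L D' V" and BD': "is_embedding L B D' (f \<circ> g)"
      unfolding D'_def using embedding_image_substruc[OF fg sB] by auto
    have onto: "(f \<circ> g) ` universe B = universe D'"
      by (simp add: D'_def)
    have "isomorphic L B D'"
      using BD' onto unfolding isomorphic_def by blast
    then have "isomorphic L D' D"
      using isomorphic_sym[OF sB] BD isomorphic_trans by blast
    then have "D' \<in> copies L V D"
      using subD' by (simp add: copies_def)
    \<comment> \<open>Each copy of \<open>A\<close> in \<open>D'\<close> is pulled back to \<open>B\<close>, where the enumeration \<open>a\<close> is transported.\<close>
    have pull: "\<exists>e. is_embedding L A0 B e \<and> X = V\<lparr>universe := f ` set (map g (map e a))\<rparr>"
      if X: "X \<in> copies L D' A" for X
    proof -
      obtain h where h: "is_embedding L A0 X h" "h ` universe A0 = universe X"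
        using iso[OF X] by blast
      have subX: "substruc L X D'"
        using X by (simp add: copies_def)
      let ?i = "inv_into (universe B) (f \<circ> g)"
      let ?e = "?i \<circ> (id \<circ> h)"
      have "is_embedding L A0 D' (id \<circ> h)"
        using h(1) is_embedding_substruc[OF subX] by (rule is_embedding_comp)
      then have "is_embedding L A0 B ?e"
        using is_embedding_inv_into[OF sB BD' onto] by (rule is_embedding_comp)
      moreover have "f (g (?e x)) = h x" if "x \<in> universe A0" for x
      proof -
        have "h x \<in> (f \<circ> g) ` universe B"
          using that h(2) subX onto by (auto simp: substruc_def)
        then show ?thesis
          using f_inv_into_f[of "h x" "f \<circ> g" "universe B"] by simp
      qed
      then have "f ` set (map g (map ?e a)) = universe X"
        using a(2) h(2) by (simp add: image_image)
      moreover have "X = V\<lparr>universe := universe X\<rparr>"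
        using substruc_trans[OF subX subD'] by (simp add: substruc_def)
      ultimately show ?thesis
        by metis
    qed
    have incA0: "a \<in> increasing_tuples s A0 (length a)"
      using a subA0 by (elim substruc_eq_restrict) (auto simp: increasing_tuples_def below_def)
    have "c X = c Y" if XY: "X \<in> copies L D' A" "Y \<in> copies L D' A" for X Y
    proof -
      obtain e where e: "is_embedding L A0 B e" "X = V\<lparr>universe := f ` set (map g (map e a))\<rparr>"
        using pull[OF XY(1)] by blast
      obtain e' where e': "is_embedding L A0 B e'" "Y = V\<lparr>universe := f ` set (map g (map e' a))\<rparr>"
        using pull[OF XY(2)] by blast
      have "is_embedding L A0 V (id \<circ> e)" "is_embedding L A0 V (id \<circ> e')"
        using e(1) e'(1) is_embedding_substruc[OF subB] by (blast intro: is_embedding_comp)+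
      then have "qf_equiv L V (map e a) (map e' a)"
        using embedding_qf_equiv[OF sA0, of V "id \<circ> e" "id \<circ> e'" a] a(2) by simp
      moreover have "map e a \<in> increasing_tuples s B (length a)"
        "map e' a \<in> increasing_tuples s B (length a)"
        using increasing_tuple_embedding[OF s _ incA0] e(1) e'(1) by blast+
      ultimately have "?c (map g (map e a)) = ?c (map g (map e' a))"
        using g unfolding color_homogenizing_def by blast
      then show ?thesis
        using e(2) e'(2) by simp
    qed
    then show ?thesis
      using \<open>D' \<in> copies L V D\<close> by blast
  qed
qed

theorem theorem4p2:
  fixes LV :: "('f, 'r) signature" and V :: "('f, 'r, 'v) struc" and s :: 'r
    and LW :: "('g, 's) signature" and W :: "('g, 's, 'w) struc" and t :: 's
  assumes "ordered_struc LV s V"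
    and "ordered_struc LW t W"
    and "locally_finite LV V"
    and "\<exists>f. increasing_fun t W s V f \<and>
          (\<forall>m\<ge>1. \<forall>k\<ge>1. \<forall>B c.
            substruc LV B V \<and> finite (universe B) \<and>
            is_coloring k (increasing_tuples t W m) c \<longrightarrow>
            (\<exists>g. color_homogenizing LV s V t W m c B g \<and> is_embedding LV B V (f \<circ> g)))"
  shows "has_RP LV V"
proof -
  have V: "is_struc LV V"
    using assms(1) by (simp add: ordered_struc_def)
  obtain f where f: "\<And>m k B c. m \<ge> 1 \<Longrightarrow> k \<ge> 1 \<Longrightarrow> substruc LV B V \<Longrightarrow> finite (universe B) \<Longrightarrow>
      is_coloring k (increasing_tuples t W m) c \<Longrightarrow>
      \<exists>g. color_homogenizing LV s V t W m c B g \<and> is_embedding LV B V (f \<circ> g)"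
    using assms(4) by metis
  show ?thesis
    unfolding has_RP_def class_has_RP_def
  proof (intro ballI allI impI)
    fix A D and k :: nat
    assume A: "A \<in> age LV V" and D: "D \<in> age LV V" and k: "k \<ge> 2"
    show "\<exists>C\<in>age LV V. \<forall>c. is_coloring k (copies LV C A) c \<longrightarrow>
      (\<exists>D'\<in>copies LV C D. \<forall>X\<in>copies LV D' A. \<forall>Y\<in>copies LV D' A. c X = c Y)"
    proof (rule finite_ramsey_witness[OF V assms(3) D])
      show "k > 0"
        using k by simp
      show "\<exists>D'\<in>copies LV V D. \<forall>X\<in>copies LV D' A. \<forall>Y\<in>copies LV D' A. c X = c Y"
        if "\<And>X. c X < k" for c
      proof (rule monochromatic_copy[OF assms(1,3) A D _ that])
        have "k \<ge> 1"
          using k by simp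
        then show "\<exists>g. color_homogenizing LV s V t W m c' B g \<and> is_embedding LV B V (f \<circ> g)"
          if "m \<ge> 1" "substruc LV B V" "finite (universe B)"
            "is_coloring k (increasing_tuples t W m) c'" for m B c'
          using f that by blast
      qed
    qed
  qed
qed

end
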